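(* Let $G$ be a graph of order $n$ with $D(G) = d$. If the distinguishing number of a determining set of $G$ of size $\mathrm{Det}(G)$, say $A$ (as a subset of $V(G)$), is $d-1$, then $$\rho_d(G) \leq \min\{n - \mathrm{Det}(G),\ \rho_{d-1}(G[A])\},$$ where $G[A]$ is the induced subgraph of $G$ generated by the vertices in $A$.
   Context: Graphs are simple; the order of a graph is its number of vertices. For a graph $G$ with vertex set $V(G)$ and automorphism group $\mathrm{Aut}(G)$, a labeling $\phi : V(G) \to \{1,\ldots,r\}$ is $r$-distinguishing if for every non-trivial $\sigma \in \mathrm{Aut}(G)$ there is a vertex $x$ with $\phi(x) \neq \phi(\sigma x)$. The distinguishing number $D(G)$ is the minimum $r$ such that $G$ has an $r$-distinguishing labeling. For a subset $W \subseteq V(G)$, a labeling $f : W \to \{1,\ldots,r\}$ is called $r$-distinguishing if every automorphism of $G$ that fixes $W$ setwise and preserves the label classes of $W$ fixes $W$ pointwise (such an automorphism may still permute vertices outside $W$); $W$ is $r$-distinguishable if it has an $r$-distinguishing labeling, and the distinguishing number of the set $W$ is the least $r$ for which $W$ is $r$-distinguishable. A subset $S \subseteq V(G)$ is a determining set for $G$ if whenever $g,h \in \mathrm{Aut}(G)$ satisfy $g(s) = h(s)$ for all $s \in S$, then $g = h$. The determining number $\mathrm{Det}(G)$ is the minimum cardinality of a determining set of $G$. For a graph $G$ with $D(G) = d$, the cost of $d$-distinguishing $G$, denoted $\rho_d(G)$, is the minimum size of a label class in any $d$-distinguishing labeling of $G$; likewise $\rho_{d-1}(G[A])$ denotes the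 minimum size of a label class in any $(d-1)$-distinguishing labeling of the graph $G[A]$. *)

theory Defs
  imports
    "Graph_Theory.Digraph_Component"
    "HOL-Combinatorics.Permutations"
    "HOL-Library.Extended_Nat"
begin

text \<open>
  A finite simple graph is a digraph satisfying the locale predicate \<open>graph\<close>: finite, symmetric,
  without loops or parallel arcs. An undirected edge is a pair of opposite arcs. As there are no
  parallel arcs, an automorphism is determined by its action on the vertices; \<open>permutes\<close> makes it
  the identity outside the vertex set, so that the trivial automorphism is \<open>id\<close> and equality
  of automorphisms is equality of functions.
\<close>

definition Aut :: "('a, 'b) pre_digraph \<Rightarrow> ('a \<Rightarrow> 'a) set" where
  "Aut G = {\<sigma>. \<sigma> permutes verts G \<and>
     (\<forall>u\<in>verts G. \<forall>v\<in>verts G. \<sigma> u \<rightarrow>\<^bsub>G\<^esub> \<sigma> v \<longleftrightarrow> u \<rightarrow>\<^bsub>G\<^esub> v)}"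

definition distinguishing_labeling ::
    "('a, 'b) pre_digraph \<Rightarrow> nat \<Rightarrow> ('a \<Rightarrow> nat) \<Rightarrow> bool" where
  "distinguishing_labeling G r \<phi> \<longleftrightarrow>
     \<phi> \<in> verts G \<rightarrow> {1..r} \<and>
     (\<forall>\<sigma>\<in>Aut G. \<sigma> \<noteq> id \<longrightarrow> (\<exists>x\<in>verts G. \<phi> x \<noteq> \<phi> (\<sigma> x)))"

definition distinguishing_number :: "('a, 'b) pre_digraph \<Rightarrow> nat" where
  "distinguishing_number G = (LEAST r. \<exists>\<phi>. distinguishing_labeling G r \<phi>)"

definition set_distinguishing_labeling ::
    "('a, 'b) pre_digraph \<Rightarrow> 'a set \<Rightarrow> nat \<Rightarrow> ('a \<Rightarrow> nat) \<Rightarrow> bool" where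
  "set_distinguishing_labeling G W r f \<longleftrightarrow>
     f \<in> W \<rightarrow> {1..r} \<and>
     (\<forall>\<sigma>\<in>Aut G. \<sigma> ` W = W \<and> (\<forall>w\<in>W. f (\<sigma> w) = f w) \<longrightarrow> (\<forall>w\<in>W. \<sigma> w = w))"

text \<open>The empty set is \<open>0\<close>-distinguishable, so its distinguishing number is \<open>0\<close>.\<close>

definition set_distinguishing_number :: "('a, 'b) pre_digraph \<Rightarrow> 'a set \<Rightarrow> nat" where
  "set_distinguishing_number G W = (LEAST r. \<exists>f. set_distinguishing_labeling G W r f)"

definition determining_set :: "('a, 'b) pre_digraph \<Rightarrow> 'a set \<Rightarrow> bool" where
  "determining_set G S \<longleftrightarrow>
     S \<subseteq> verts G \<and> (\<forall>g\<in>Aut G. \<forall>h\<in>Aut G. (\<forall>s\<in>S. g s = h s) \<longrightarrow> g = h)"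

definition Det :: "('a, 'b) pre_digraph \<Rightarrow> nat" where
  "Det G = (LEAST k. \<exists>S. determining_set G S \<and> card S = k)"

text \<open>
  The minimum ranges over all \<open>r\<close>-distinguishing labelings and all their label classes, a
  class for each label in \<open>{1..r}\<close>. For \<open>r = distinguishing_number G\<close> every class is nonempty:
  an unused label could be dropped. If there is nothing to minimise over (no such labeling,
  or \<open>r = 0\<close>), the value is \<open>\<infinity>\<close>.
\<close>

definition cost :: "nat \<Rightarrow> ('a, 'b) pre_digraph \<Rightarrow> enat" (\<open>\<rho>\<close>) where
  "\<rho> r G = (INF \<phi>\<in>{\<phi>. distinguishing_labeling G r \<phi>}. INF i\<in>{1..r}.
              enat (card {v \<in> verts G. \<phi> v = i}))"

end

theory Submission
  imports Defs
begin

text \<open>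
  A labeling \<open>f\<close> of a determining set \<open>A\<close> that is distinguishing for \<open>A\<close> as a set becomes a
  distinguishing labeling of the whole graph once all vertices outside \<open>A\<close> receive one fresh label
  (\<open>distinguishing_labeling_fresh_outside\<close>): the fresh label forces a label-preserving automorphism
  to map \<open>A\<close> onto itself, so that \<open>f\<close> pins down every vertex of \<open>A\<close>, and fixing a determining set
  pointwise means being trivial. The two bounds come from looking at different label classes of such
  extensions. The class of the fresh label is the complement of \<open>A\<close>, of size \<open>n - Det G\<close>. The
  other classes are label classes of \<open>f\<close>; here \<open>f\<close> may be any distinguishing labeling of the induced
  graph on \<open>A\<close>, because automorphisms of \<open>G\<close> that preserve \<open>A\<close> restrict to automorphisms of the
  induced graph (\<open>set_distinguishing_labeling_if_induced\<close>).
\<close>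

lemma id_in_Aut: "id \<in> Aut G"
  by (simp add: Aut_def permutes_id)

lemma Aut_fixing_determining_set_eq_id:
  assumes "determining_set G A" "\<sigma> \<in> Aut G" "\<And>a. a \<in> A \<Longrightarrow> \<sigma> a = a"
  shows "\<sigma> = id"
  using assms id_in_Aut[of G] unfolding determining_set_def by simp

lemma dominates_induce_subgraph_iff:
  assumes "u \<in> A" "v \<in> A"
  shows "u \<rightarrow>\<^bsub>G \<restriction> A\<^esub> v \<longleftrightarrow> u \<rightarrow>\<^bsub>G\<^esub> v"
  using assms by (auto simp: arcs_ends_def arc_to_ends_def induce_subgraph_def)

lemma Aut_restrict_induce_subgraph:
  assumes "\<sigma> \<in> Aut G" "A \<subseteq> verts G" "\<sigma> ` A = A"
  shows "(\<lambda>x. if x \<in> A then \<sigma> x else x) \<in> Aut (G \<restriction> A)"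
proof -
  let ?\<tau> = "\<lambda>x. if x \<in> A then \<sigma> x else x"
  have perm: "\<sigma> permutes verts G"
    and pres: "\<And>u v. u \<in> verts G \<Longrightarrow> v \<in> verts G \<Longrightarrow> \<sigma> u \<rightarrow>\<^bsub>G\<^esub> \<sigma> v \<longleftrightarrow> u \<rightarrow>\<^bsub>G\<^esub> v"
    using assms(1) by (auto simp: Aut_def)
  have "inj_on \<sigma> A"
    using permutes_inj[OF perm] by (rule inj_on_subset) simp
  then have "bij_betw \<sigma> A A"
    using assms(3) by (simp add: bij_betw_def)
  then have "bij_betw ?\<tau> A A"
    by (simp cong: bij_betw_cong)
  then have "?\<tau> permutes A"
    by (rule bij_imp_permutes) simp
  moreover have "?\<tau> u \<rightarrow>\<^bsub>G \<restriction> A\<^esub> ?\<tau> v \<longleftrightarrow> u \<rightarrow>\<^bsub>G \<restriction> A\<^esub> v" if "u \<in> A" "v \<in> A" for u v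
  proof -
    have "\<sigma> u \<in> A" "\<sigma> v \<in> A"
      using that assms(3) by auto
    then show ?thesis
      using that assms(2) pres[of u v] by (auto simp: dominates_induce_subgraph_iff)
  qed
  ultimately show ?thesis
    by (simp add: Aut_def)
qed

text \<open>
  Being distinguishing for the induced graph is the stronger condition: it concerns all automorphisms
  of the induced graph, whereas the labeling of a set is tested only against those that extend to
  the whole graph.
\<close>

lemma set_distinguishing_labeling_if_induced:
  assumes "A \<subseteq> verts G" "distinguishing_labeling (G \<restriction> A) r f"
  shows "set_distinguishing_labeling G A r f"
  unfolding set_distinguishing_labeling_def
proof (intro conjI ballI impI)
  show "f \<in> A \<rightarrow> {1..r}"
    using assms(2) by (simp add: distinguishing_labeling_def)
next
  fix \<sigma> w
  assume \<sigma>: "\<sigma> \<in> Aut G" "\<sigma> ` A = A \<and> (\<forall>w\<in>A. f (\<sigma> w) = f w)" and "w \<in> A"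
  let ?\<tau> = "\<lambda>x. if x \<in> A then \<sigma> x else x"
  have "?\<tau> \<in> Aut (G \<restriction> A)"
    using \<sigma> assms(1) by (intro Aut_restrict_induce_subgraph) auto
  moreover have "\<forall>x\<in>A. f x = f (?\<tau> x)"
    using \<sigma>(2) by simp
  ultimately have "?\<tau> = id"
    using assms(2) unfolding distinguishing_labeling_def induce_subgraph_verts by blast
  from fun_cong[OF this, of w] show "\<sigma> w = w"
    using \<open>w \<in> A\<close> by simp
qed

lemma distinguishing_labeling_fresh_outside:
  assumes "determining_set G A" "finite A" "set_distinguishing_labeling G A r f"
  shows "distinguishing_labeling G (Suc r) (\<lambda>x. if x \<in> A then f x else Suc r)"
  unfolding distinguishing_labeling_def
proof (intro conjI ballI impI)
  let ?\<phi> = "\<lambda>x. if x \<in> A then f x else Suc r"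
  have A: "A \<subseteq> verts G"
    using assms(1) by (simp add: determining_set_def)
  have f: "1 \<le> f x \<and> f x \<le> r" if "x \<in> A" for x
    using assms(3) that by (auto simp: set_distinguishing_labeling_def Pi_iff)
  show "?\<phi> \<in> verts G \<rightarrow> {1..Suc r}"
    using f by (auto simp: le_SucI)
  fix \<sigma> assume \<sigma>: "\<sigma> \<in> Aut G" "\<sigma> \<noteq> id"
  show "\<exists>x\<in>verts G. ?\<phi> x \<noteq> ?\<phi> (\<sigma> x)"
  proof (rule ccontr)
    assume "\<not> ?thesis"
    then have pres: "?\<phi> x = ?\<phi> (\<sigma> x)" if "x \<in> A" for x
      using A that by blast
    have in_A: "\<sigma> x \<in> A" if "x \<in> A" for x
      using pres[OF that] f[OF that] that by (auto split: if_splits)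
    have "inj_on \<sigma> A"
      using \<sigma>(1) permutes_inj[of \<sigma> "verts G"] by (auto simp: Aut_def intro: inj_on_subset)
    then have "\<sigma> ` A = A"
      using in_A assms(2) by (intro endo_inj_surj) auto
    moreover have "f (\<sigma> x) = f x" if "x \<in> A" for x
      using pres[OF that] in_A[OF that] that by simp
    ultimately have "\<sigma> x = x" if "x \<in> A" for x
      using assms(3) \<sigma>(1) that by (auto simp: set_distinguishing_labeling_def)
    then show False
      using Aut_fixing_determining_set_eq_id[OF assms(1) \<sigma>(1)] \<sigma>(2) by blast
  qed
qed

text \<open>
  An injective labeling distinguishes a finite set, so the least number of labels in the
  definition is attained.
\<close>

lemma set_distinguishing_number_attained:
  assumes "finite W"
  shows "\<exists>f. set_distinguishing_labeling G W (set_distinguishing_number G W) f"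
proof -
  obtain h where h: "bij_betw h W {1..card W}"
    using ex_bij_betw_finite_nat[OF assms] finite_same_card_bij[OF assms, of "{1..card W}"] by auto
  have "set_distinguishing_labeling G W (card W) h"
    unfolding set_distinguishing_labeling_def
  proof (intro conjI ballI impI)
    show "h \<in> W \<rightarrow> {1..card W}"
      using h by (auto simp: bij_betw_def)
  next
    fix \<sigma> w
    assume "\<sigma> ` W = W \<and> (\<forall>w\<in>W. h (\<sigma> w) = h w)" "w \<in> W"
    moreover from this have "\<sigma> w \<in> W"
      by blast
    ultimately show "\<sigma> w = w"
      using h by (auto simp: bij_betw_def dest: inj_onD)
  qed
  then have "\<exists>r f. set_distinguishing_labeling G W r f"
    by blast
  then show ?thesis
    unfolding set_distinguishing_number_def by (rule LeastI_ex)
qed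

lemma cost_le:
  assumes "distinguishing_labeling G r \<phi>" "i \<in> {1..r}"
  shows "\<rho> r G \<le> enat (card {v \<in> verts G. \<phi> v = i})"
  unfolding cost_def using assms
  by (intro INF_lower2[where i = \<phi>] INF_lower2[where i = i]) auto

lemma cost_Suc_le_card_outside:
  assumes "determining_set G A" "finite A" "set_distinguishing_labeling G A r f"
  shows "\<rho> (Suc r) G \<le> enat (card (verts G - A))"
proof -
  have "f x \<noteq> Suc r" if "x \<in> A" for x
    using assms(3) that by (auto simp: set_distinguishing_labeling_def Pi_iff)
  then have "{v \<in> verts G. (if v \<in> A then f v else Suc r) = Suc r} = verts G - A"
    by auto
  then show ?thesis
    using cost_le[OF distinguishing_labeling_fresh_outside[OF assms], of "Suc r"] by simp
qed

text \<open>
  Every old label class survives unchanged under the extension by a fresh label, so each value in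
  the minimum for the induced graph also occurs in the minimum for the whole graph.
\<close>

lemma cost_Suc_le_cost_induced:
  assumes "determining_set G A" "finite A"
  shows "\<rho> (Suc r) G \<le> \<rho> r (G \<restriction> A)"
  unfolding cost_def[of r "G \<restriction> A"]
proof (intro INF_greatest)
  fix f i
  assume "f \<in> {\<phi>. distinguishing_labeling (G \<restriction> A) r \<phi>}" and i: "i \<in> {1..r}"
  moreover have A: "A \<subseteq> verts G"
    using assms(1) by (simp add: determining_set_def)
  ultimately have "set_distinguishing_labeling G A r f"
    by (simp add: set_distinguishing_labeling_if_induced)
  from distinguishing_labeling_fresh_outside[OF assms this]
  have "\<rho> (Suc r) G \<le> enat (card {v \<in> verts G. (if v \<in> A then f v else Suc r) = i})"
    using i by (intro cost_le) auto
  also have "{v \<in> verts G. (if v \<in> A then f v else Suc r) = i} = {v \<in> verts (G \<restriction> A). f v = i}"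
    using A i by auto
  finally show "\<rho> (Suc r) G \<le> enat (card {v \<in> verts (G \<restriction> A). f v = i})" .
qed

theorem corollary2p6:
  fixes G :: "('a, 'b) pre_digraph" and A :: "'a set" and n d :: nat
  assumes "graph G"
    and "card (verts G) = n"
    and "distinguishing_number G = d"
    and "determining_set G A"
    and "card A = Det G"
    and "set_distinguishing_number G A + 1 = d"
  shows "\<rho> d G \<le> min (enat (n - Det G)) (\<rho> (d - 1) (G \<restriction> A))"
proof -
  interpret graph G by fact
  have A: "A \<subseteq> verts G"
    using assms(4) by (simp add: determining_set_def)
  then have fin: "finite A"
    by (rule finite_subset) simp
  have d: "d = Suc (set_distinguishing_number G A)"
    using assms(6) by simp
  obtain f where "set_distinguishing_labeling G A (set_distinguishing_number G A) f"
    using set_distinguishing_number_attained[OF fin] by blast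
  then have "\<rho> d G \<le> enat (card (verts G - A))"
    using cost_Suc_le_card_outside[OF assms(4) fin] d by simp
  also have "card (verts G - A) = n - Det G"
    using A fin assms(2,5) by (simp add: card_Diff_subset)
  finally show ?thesis
    using cost_Suc_le_cost_induced[OF assms(4) fin] d by simp
qed

end
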